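(* Let $\mathcal{E}, f, S, A, b, \mathrm{Feas}, \bar e, f^*, \hat f$ be as in the context, and assume in addition that $S$ is polyhedral and $f$ is piecewise linear (that is, $\mathrm{epi}(f)$ is polyhedral). Then there exist constants $C_1$ and $C_2$ (depending on the problem data but not on $\epsilon$) such that the sequence $\{x_k'\}_{k\ge0}$ of feasible points generated by Algorithm B (described in the context) satisfies, for all $0<\epsilon<1$ and all nonnegative integers $\ell$, $$\ell\ \ge\ C_1\log(1/\epsilon)+C_2\quad\Longrightarrow\quad\min_{k\le\ell}\frac{f(x_k')-f^*}{\hat f-f^*}\le\epsilon .$$
   Context: **Problem.** $\mathcal{E}$ is a finite-dimensional real vector space with inner product $\langle\cdot,\cdot\rangle$ and associated norm $\|\cdot\|$. $f:\mathcal{E}\to(-\infty,\infty]$ is a lower-semicontinuous convex function, $\mathrm{dom}(f)=\{x: f(x)<\infty\}$, $\mathrm{epi}(f)=\{(x,t)\in\mathcal E\times\mathbb R: x\in\mathrm{dom}(f),\ t\ge f(x)\}$. $S\subseteq\mathcal{E}$ is a closed convex set with nonempty interior, $A$ is a linear map from $\mathcal E$ to a finite-dimensional real vector space, $b$ is a vector in that space, and $\mathrm{Feas}=\{x\in S: Ax=b\}$. The problem is $\min f(x)$ s.t. $x\in\mathrm{Feas}$. The point $\bar e\in\mathrm{int}(S\cap\mathrm{dom}(f))$ satisfies $A\bar e=b$. The diameter of $\{x\in\mathrm{Feas}: f(x)\le f(\bar e)\}$ is assumed finite; hence the optimal value $f^*$ is attained. $\hat f$ is a real number with $\hat f>f(\bar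 e)$. **Line search.** For $x\in\mathcal E$, $t\in\mathbb R$ and scalars $\alpha$ let $x(\alpha)=\bar e+\alpha(x-\bar e)$, $t(\alpha)=\hat f+\alpha(t-\hat f)$; $\alpha_1(x)=\sup\{\alpha: x(\alpha)\in S\}$, $\alpha_2(x,t)=\sup\{\alpha: f(x(\alpha))\le t(\alpha)\}$, $\alpha(x,t)=\min\{\alpha_1(x),\alpha_2(x,t)\}$ (positive and finite whenever $Ax=b$ and $t<\hat f$). For such $(x,t)$, let $\pi'(x,t)=(\bar e,\hat f)+\alpha(x,t)\cdot((x,t)-(\bar e,\hat f))$. **The sets $G$.** $N_C(p)=\{v:\langle v,q-p\rangle\le0\ \forall q\in C\}$ denotes the normal cone; on $\mathcal E\times\mathbb R$ the inner product $\langle x_1,x_2\rangle+t_1t_2$ is used. $\mathrm{bdy}$ denotes boundary. For $x'\in\mathrm{bdy}(S)$, $$G_1(x')=\Big\{\tfrac{-1}{\langle v,\bar e-x'\rangle}v : 0\ne v\in N_S(x')\Big\};$$ for $(x',t')\in\mathrm{bdy}(\mathrm{epi}(f))$, $$G_2(x',t')=\Big\{\tfrac{-1}{\langle v,\bar e-x'\rangle+(\hat f-t')\delta}v : (0,0)\ne(v,\delta)\in N_{\mathrm{epi}(f)}(x',t')\Big\}.$$ With $\mathrm{bdy}_1=\{(x',t'):x'\in\mathrm{bdy}(S)\}$ and $\mathrm{bdy}_2=\mathrm{bdy}(\mathrm{epi}(f))$, let $G(x',t')=G_1(x')$ if $(x',t')\in\mathrm{bdy}_1\setminus\mathrm{bdy}_2$;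 $G(x',t')=G_2(x',t')$ if $(x',t')\in\mathrm{bdy}_2\setminus\mathrm{bdy}_1$; and $G(x',t')$ is the convex hull of $G_1(x')\cup G_2(x',t')$ if $(x',t')\in\mathrm{bdy}_1\cap\mathrm{bdy}_2$. $P$ denotes orthogonal projection onto $\ker A$. **Algorithm B.** Input: $f^*$, $\bar e$, $\hat f$. Initialize $x_0=\bar e$, $(x_0',t_0')=(\bar e,f(\bar e))$, $\alpha_0=\alpha(x_0,f^* )$. Iterate for $k=0,1,2,\dots$: - Compute $x_{k+1}=x_k+\frac{\alpha_k-1}{\alpha_k\|P(g')\|^2}P(g')$, where $g'$ is any element of $G(x_k',t_k')$ (with $x_{k+1}=x_k$ if $P(g')=0$). - Let $(x_{k+1}',t_{k+1}')=\pi'(x_{k+1},f^* )$ and $\alpha_{k+1}=\alpha(x_{k+1},f^* )$. *)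

theory Defs
  imports "HOL-Analysis.Analysis"
begin

section \<open>Extended-real-valued convex functions\<close>

definition lower_semicont :: "('a::topological_space \<Rightarrow> ereal) \<Rightarrow> bool" where
  "lower_semicont f \<longleftrightarrow> (\<forall>x. f x \<le> Liminf (at x) f)"

text \<open>Only used for functions that never take the value \<open>-\<infinity>\<close>; then the right-hand side
  is never of the form \<open>\<infinity> - \<infinity>\<close>, and \<open>0 * \<infinity> = 0\<close> makes the cases \<open>u = 0\<close> and \<open>v = 0\<close> trivial.\<close>

definition convex_ereal :: "('a::real_vector \<Rightarrow> ereal) \<Rightarrow> bool" where
  "convex_ereal f \<longleftrightarrow>
     (\<forall>x y. \<forall>u\<ge>0. \<forall>v\<ge>0. u + v = 1 \<longrightarrow>
        f (u *\<^sub>R x + v *\<^sub>R y) \<le> ereal u * f x + ereal v * f y)"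

definition edom :: "('a \<Rightarrow> ereal) \<Rightarrow> 'a set" where
  "edom f = {x. f x < \<infinity>}"

definition epi :: "('a \<Rightarrow> ereal) \<Rightarrow> ('a \<times> real) set" where
  "epi f = {(x, t). x \<in> edom f \<and> f x \<le> ereal t}"

definition Feas :: "'a set \<Rightarrow> ('a \<Rightarrow> 'b) \<Rightarrow> 'b \<Rightarrow> 'a set" where
  "Feas S A b = {x \<in> S. A x = b}"


section \<open>Line search\<close>

text \<open>The suprema are taken in the extended reals: each of them may be infinite on its own.\<close>

definition alpha1 :: "'a::real_vector set \<Rightarrow> 'a \<Rightarrow> 'a \<Rightarrow> ereal" where
  "alpha1 S e x = (SUP a\<in>{a::real. e + a *\<^sub>R (x - e) \<in> S}. ereal a)"

definition alpha2 :: "('a::real_vector \<Rightarrow> ereal) \<Rightarrow> 'a \<Rightarrow> real \<Rightarrow> 'a \<Rightarrow> real \<Rightarrow> ereal" where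
  "alpha2 f e fhat x t =
     (SUP a\<in>{a::real. f (e + a *\<^sub>R (x - e)) \<le> ereal (fhat + a * (t - fhat))}. ereal a)"

text \<open>The minimum is finite whenever \<open>A x = b\<close> and \<open>t < fhat\<close>, the only case of interest,
  so that nothing is lost by the conversion to a real number.\<close>

definition alpha ::
  "'a::real_vector set \<Rightarrow> ('a \<Rightarrow> ereal) \<Rightarrow> 'a \<Rightarrow> real \<Rightarrow> 'a \<Rightarrow> real \<Rightarrow> real" where
  "alpha S f e fhat x t = real_of_ereal (min (alpha1 S e x) (alpha2 f e fhat x t))"

definition radial_proj ::
  "'a::real_vector set \<Rightarrow> ('a \<Rightarrow> ereal) \<Rightarrow> 'a \<Rightarrow> real \<Rightarrow> 'a \<Rightarrow> real \<Rightarrow> 'a \<times> real" where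
  "radial_proj S f e fhat x t = (e, fhat) + alpha S f e fhat x t *\<^sub>R ((x, t) - (e, fhat))"


section \<open>Normal cones and the sets \<open>G\<close>\<close>

definition normal_cone :: "'a::real_inner set \<Rightarrow> 'a \<Rightarrow> 'a set" where
  "normal_cone C p = {v. \<forall>q\<in>C. v \<bullet> (q - p) \<le> 0}"

definition G1 :: "'a::real_inner set \<Rightarrow> 'a \<Rightarrow> 'a \<Rightarrow> 'a set" where
  "G1 S e x' = {(- 1 / (v \<bullet> (e - x'))) *\<^sub>R v | v. v \<noteq> 0 \<and> v \<in> normal_cone S x'}"

definition G2 :: "('a::real_inner \<Rightarrow> ereal) \<Rightarrow> 'a \<Rightarrow> real \<Rightarrow> 'a \<Rightarrow> real \<Rightarrow> 'a set" where
  "G2 f e fhat x' t' =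
     {(- 1 / (v \<bullet> (e - x') + (fhat - t') * d)) *\<^sub>R v | v d.
        (v, d) \<noteq> (0, 0) \<and> (v, d) \<in> normal_cone (epi f) (x', t')}"

definition bdy1 :: "'a::topological_space set \<Rightarrow> ('a \<times> real) set" where
  "bdy1 S = {(x', t'). x' \<in> frontier S}"

definition bdy2 :: "('a::topological_space \<Rightarrow> ereal) \<Rightarrow> ('a \<times> real) set" where
  "bdy2 f = frontier (epi f)"

text \<open>\<open>G\<close> is only meaningful on \<open>bdy1 S \<union> bdy2 f\<close>, which contains all points at which
  Algorithm B evaluates it; the value \<open>{}\<close> elsewhere is never used.\<close>

definition G ::
  "'a::real_inner set \<Rightarrow> ('a \<Rightarrow> ereal) \<Rightarrow> 'a \<Rightarrow> real \<Rightarrow> 'a \<Rightarrow> real \<Rightarrow> 'a set" where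
  "G S f e fhat x' t' =
     (if (x', t') \<in> bdy1 S - bdy2 f then G1 S e x'
      else if (x', t') \<in> bdy2 f - bdy1 S then G2 f e fhat x' t'
      else if (x', t') \<in> bdy1 S \<inter> bdy2 f then convex hull (G1 S e x' \<union> G2 f e fhat x' t')
      else {})"

definition orth_proj :: "'a::real_inner set \<Rightarrow> 'a \<Rightarrow> 'a" where
  "orth_proj V x = (THE y. y \<in> V \<and> (\<forall>z\<in>V. orthogonal (x - y) z))"


section \<open>Algorithm B\<close>

text \<open>\<open>algorithm_B\<close> holds of every run of the algorithm; \<open>g k\<close> is the (arbitrary) element of
  \<open>G\<close> chosen in iteration \<open>k\<close>.\<close>

definition algorithm_B ::
  "'a::real_inner set \<Rightarrow> ('a \<Rightarrow> ereal) \<Rightarrow> ('a \<Rightarrow> 'b::zero) \<Rightarrow> 'a \<Rightarrow> real \<Rightarrow> real \<Rightarrow>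
   (nat \<Rightarrow> 'a) \<Rightarrow> (nat \<Rightarrow> 'a) \<Rightarrow> (nat \<Rightarrow> real) \<Rightarrow> (nat \<Rightarrow> real) \<Rightarrow> (nat \<Rightarrow> 'a) \<Rightarrow> bool" where
  "algorithm_B S f A e fhat fstar x x' t' al g \<longleftrightarrow>
     x 0 = e \<and> x' 0 = e \<and> ereal (t' 0) = f e \<and> al 0 = alpha S f e fhat (x 0) fstar \<and>
     (\<forall>k. g k \<in> G S f e fhat (x' k) (t' k) \<and>
          (let p = orth_proj {z. A z = 0} (g k) in
             x (Suc k) = (if p = 0 then x k
                          else x k + ((al k - 1) / (al k * (norm p)\<^sup>2)) *\<^sub>R p)) \<and>
          (x' (Suc k), t' (Suc k)) = radial_proj S f e fhat (x (Suc k)) fstar \<and>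
          al (Suc k) = alpha S f e fhat (x (Suc k)) fstar)"

end

theory Submission
  imports Defs
begin

text \<open>Proof idea. Let \<open>K\<close> be the part of the epigraph lying over \<open>S\<close>. On the affine space \<open>A x = b\<close>
  the function \<open>1 / alpha(x, f*)\<close> is the gauge of \<open>K\<close> about its interior point \<open>(e, fhat)\<close>; its minimum
  is 1, attained exactly at the optimal solutions, and the elements of \<open>G\<close> are subgradients of it,
  bounded by \<open>1 / r\<close> if \<open>K\<close> contains the ball of radius \<open>r\<close> about \<open>(e, fhat)\<close>. So Algorithm B is
  Polyak's projected subgradient method. Since \<open>K\<close> is polyhedral, the gauge grows at least linearly
  with the distance to the solution set, hence Polyak's step contracts this distance by a constant
  factor, and \<open>(f(x') - f*) / (fhat - f*) \<le> 1 - alpha\<close> is at most the distance divided by \<open>r\<close>.\<close>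

section \<open>Polyhedra and projections\<close>

text \<open>The adjoint of \<open>h\<close> carries each defining halfspace back to a set of the
  same form, even if the new normal is 0.\<close>

lemma polyhedron_linear_vimage:
  fixes h :: "'a::euclidean_space \<Rightarrow> 'b::euclidean_space"
  assumes h: "linear h" and S: "polyhedron S"
  shows "polyhedron (h -` S)"
proof -
  obtain F where F: "finite F" "S = \<Inter>F" "\<And>H. H \<in> F \<Longrightarrow> \<exists>a c. a \<noteq> 0 \<and> H = {x. a \<bullet> x \<le> c}"
    using S unfolding polyhedron_def by metis
  have "polyhedron (h -` H)" if "H \<in> F" for H
  proof -
    obtain a c where H: "H = {x. a \<bullet> x \<le> c}"
      using F(3) \<open>H \<in> F\<close> by blast
    have "h -` H = {x. adjoint h a \<bullet> x \<le> c}"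
      using adjoint_clauses(2)[OF h] by (auto simp: H)
    then show ?thesis
      by (simp add: polyhedron_halfspace_le)
  qed
  then have "polyhedron (\<Inter>H\<in>F. h -` H)"
    using F(1) by (intro polyhedron_Inter) auto
  moreover have "h -` S = (\<Inter>H\<in>F. h -` H)"
    using F(2) by auto
  ultimately show ?thesis
    by simp
qed

text \<open>The estimate holds on the finite generating set, where every nonzero gap is positive,
  and it passes to the convex hull.\<close>

lemma polytope_linear_sharp_min:
  fixes Q :: "'a::euclidean_space set"
  assumes Q: "polytope Q" and lower: "\<And>q. q \<in> Q \<Longrightarrow> \<gamma> \<le> c \<bullet> q" and z: "z \<in> Q" "c \<bullet> z = \<gamma>"
  obtains C where "C \<ge> 0" "\<And>q. q \<in> Q \<Longrightarrow> \<exists>y\<in>Q. c \<bullet> y = \<gamma> \<and> norm (q - y) \<le> C * (c \<bullet> q - \<gamma>)"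
proof -
  obtain V where V: "finite V" "Q = convex hull V"
    using Q unfolding polytope_def by blast
  have convexQ: "convex Q"
    using V(2) by (simp add: convex_convex_hull)
  have "\<exists>C\<ge>0. \<exists>y\<in>Q. c \<bullet> y = \<gamma> \<and> norm (v - y) \<le> C * (c \<bullet> v - \<gamma>)" if "v \<in> V" for v
  proof -
    have vQ: "v \<in> Q"
      using that V(2) by (simp add: hull_inc)
    show ?thesis
    proof (cases "c \<bullet> v = \<gamma>")
      case True
      then show ?thesis using vQ by (intro exI[of _ 0]) auto
    next
      case False
      then have "c \<bullet> v - \<gamma> > 0"
        using lower[OF vQ] by auto
      then show ?thesis
        using z by (intro exI[of _ "norm (v - z) / (c \<bullet> v - \<gamma>)"]) auto
    qed
  qed
  then obtain D where D: "\<And>v. v \<in> V \<Longrightarrow> D v \<ge> 0"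
    "\<And>v. v \<in> V \<Longrightarrow> \<exists>y\<in>Q. c \<bullet> y = \<gamma> \<and> norm (v - y) \<le> D v * (c \<bullet> v - \<gamma>)"
    by metis
  define C where "C = sum D V"
  have C0: "C \<ge> 0"
    unfolding C_def by (intro sum_nonneg D(1))
  define W where "W = {q. \<exists>y\<in>Q. c \<bullet> y = \<gamma> \<and> norm (q - y) \<le> C * (c \<bullet> q - \<gamma>)}"
  have "V \<subseteq> W"
  proof
    fix v assume v: "v \<in> V"
    have "D v \<le> C"
      unfolding C_def using v D(1) V(1) by (intro member_le_sum) auto
    moreover have "c \<bullet> v - \<gamma> \<ge> 0"
      using lower[of v] v V(2) by (simp add: hull_inc)
    ultimately have "D v * (c \<bullet> v - \<gamma>) \<le> C * (c \<bullet> v - \<gamma>)"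
      by (intro mult_right_mono)
    then show "v \<in> W"
      using D(2)[OF v] unfolding W_def by force
  qed
  \<comment> \<open>The norm is convex and the bound affine in \<open>q\<close>, so combining the
    two witnesses gives a witness for the combination.\<close>
  moreover have "convex W"
  proof (rule convexI)
    fix p q and u v :: real
    assume p: "p \<in> W" and q: "q \<in> W" and uv: "0 \<le> u" "0 \<le> v" "u + v = 1"
    obtain y where y: "y \<in> Q" "c \<bullet> y = \<gamma>" "norm (p - y) \<le> C * (c \<bullet> p - \<gamma>)"
      using p unfolding W_def by blast
    obtain y' where y': "y' \<in> Q" "c \<bullet> y' = \<gamma>" "norm (q - y') \<le> C * (c \<bullet> q - \<gamma>)"
      using q unfolding W_def by blast
    have "(u *\<^sub>R p + v *\<^sub>R q) - (u *\<^sub>R y + v *\<^sub>R y') = u *\<^sub>R (p - y) + v *\<^sub>R (q - y')"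
      by (simp add: algebra_simps)
    then have "norm ((u *\<^sub>R p + v *\<^sub>R q) - (u *\<^sub>R y + v *\<^sub>R y')) \<le> u * norm (p - y) + v * norm (q - y')"
      using norm_triangle_ineq[of "u *\<^sub>R (p - y)" "v *\<^sub>R (q - y')"] uv by simp
    also have "\<dots> \<le> u * (C * (c \<bullet> p - \<gamma>)) + v * (C * (c \<bullet> q - \<gamma>))"
      using y(3) y'(3) uv by (intro add_mono mult_left_mono)
    also have "\<dots> = C * (c \<bullet> (u *\<^sub>R p + v *\<^sub>R q) - (u + v) * \<gamma>)"
      by (simp add: algebra_simps)
    finally have "norm ((u *\<^sub>R p + v *\<^sub>R q) - (u *\<^sub>R y + v *\<^sub>R y'))
        \<le> C * (c \<bullet> (u *\<^sub>R p + v *\<^sub>R q) - \<gamma>)"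
      using uv by simp
    moreover have "c \<bullet> (u *\<^sub>R y + v *\<^sub>R y') = \<gamma>"
      using y(2) y'(2) uv by (simp add: inner_add_right flip: distrib_right)
    moreover have "u *\<^sub>R y + v *\<^sub>R y' \<in> Q"
      using convexQ y(1) y'(1) uv by (simp add: convexD)
    ultimately show "u *\<^sub>R p + v *\<^sub>R q \<in> W"
      unfolding W_def by blast
  qed
  ultimately have "Q \<subseteq> W"
    unfolding V(2) by (rule hull_minimal)
  then show ?thesis
    using that[OF C0] unfolding W_def by blast
qed

section \<open>Orthogonal projection onto a subspace\<close>

text \<open>The second part lets a subgradient be replaced by its projection when tested against
  directions in \<open>V\<close>.\<close>

lemma orth_proj_subspace:
  fixes V :: "'a::euclidean_space set"
  assumes "subspace V"
  shows "orth_proj V x \<in> V" "\<And>z. z \<in> V \<Longrightarrow> x \<bullet> z = orth_proj V x \<bullet> z"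
proof -
  obtain y z where yz: "y \<in> span V" "\<And>w. w \<in> span V \<Longrightarrow> orthogonal z w" "x = y + z"
    using orthogonal_subspace_decomp_exists[of V x] by blast
  have span: "span V = V"
    using assms by (simp add: span_eq_iff)
  have "\<exists>!y. y \<in> V \<and> (\<forall>z\<in>V. orthogonal (x - y) z)"
  proof (rule ex1I)
    show "y \<in> V \<and> (\<forall>z\<in>V. orthogonal (x - y) z)"
      using yz span by auto
  next
    fix y' assume y': "y' \<in> V \<and> (\<forall>z\<in>V. orthogonal (x - y') z)"
    then have "y' - y \<in> V"
      using yz(1) span assms by (simp add: subspace_diff)
    then have "(x - y) \<bullet> (y' - y) = 0" "(x - y') \<bullet> (y' - y) = 0"
      using y' yz span by (auto simp: orthogonal_def)
    then have "(y' - y) \<bullet> (y' - y) = 0"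
      by (simp add: inner_diff_left)
    then show "y' = y"
      by simp
  qed
  then have *: "orth_proj V x \<in> V \<and> (\<forall>z\<in>V. orthogonal (x - orth_proj V x) z)"
    unfolding orth_proj_def by (rule theI')
  then show "orth_proj V x \<in> V" "\<And>z. z \<in> V \<Longrightarrow> x \<bullet> z = orth_proj V x \<bullet> z"
    by (auto simp: orthogonal_def inner_diff_left)
qed

lemma norm_orth_proj_le:
  fixes V :: "'a::euclidean_space set"
  assumes "subspace V"
  shows "norm (orth_proj V x) \<le> norm x"
proof (cases "orth_proj V x = 0")
  case False
  have "norm (orth_proj V x) * norm (orth_proj V x) = x \<bullet> orth_proj V x"
    using orth_proj_subspace(2)[OF assms orth_proj_subspace(1)[OF assms], of x x]
    by (metis dot_square_norm power2_eq_square)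
  also have "\<dots> \<le> norm x * norm (orth_proj V x)"
    by (rule norm_cauchy_schwarz)
  finally show ?thesis
    using False by simp
qed simp

section \<open>Normal vectors seen from an interior point\<close>

text \<open>A small step from \<open>p\<close> along \<open>v\<close> stays in \<open>C\<close>,
  which leaves strict room in the normal inequality. Hence the denominators in \<open>G1\<close> and
  \<open>G2\<close> are negative.\<close>

lemma inner_neg_of_interior:
  fixes v :: "'a::euclidean_space"
  assumes "p \<in> interior C" "v \<noteq> 0" "v \<in> normal_cone C q"
  shows "v \<bullet> (p - q) < 0"
proof -
  obtain r where r: "r > 0" "cball p r \<subseteq> C"
    using assms(1) mem_interior_cball by blast
  have "p + (r / norm v) *\<^sub>R v \<in> C"
    using r assms(2) by (intro subsetD[OF r(2)]) (simp add: dist_norm)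
  then have "v \<bullet> (p + (r / norm v) *\<^sub>R v - q) \<le> 0"
    using assms(3) unfolding normal_cone_def by blast
  then have "v \<bullet> (p - q) + (r / norm v) * (v \<bullet> v) \<le> 0"
    by (simp add: algebra_simps)
  moreover have "(r / norm v) * (v \<bullet> v) > 0"
    using r assms(2) by simp
  ultimately show ?thesis
    by linarith
qed

text \<open>With \<open>C = S\<close> and \<open>C = epi f\<close> this makes the elements of \<open>G\<close> subgradients at \<open>p + q\<close> of
  the gauge of \<open>C\<close> about \<open>p\<close>.\<close>

lemma scaled_normal:
  fixes w :: "'c::euclidean_space"
  assumes p: "p \<in> interior C" and w: "w \<noteq> 0" "w \<in> normal_cone C (p + a *\<^sub>R q)" and a: "a > 0"
  shows "((- 1 / (w \<bullet> (p - (p + a *\<^sub>R q)))) *\<^sub>R w) \<bullet> q = 1 / a"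
    "\<And>z. z \<in> C \<Longrightarrow> ((- 1 / (w \<bullet> (p - (p + a *\<^sub>R q)))) *\<^sub>R w) \<bullet> (z - p) \<le> 1"
proof -
  \<comment> \<open>The scaled vector is \<open>w\<close> divided by this positive number.\<close>
  have pos: "w \<bullet> (a *\<^sub>R q) > 0"
    using inner_neg_of_interior[OF p w] by simp
  then show "((- 1 / (w \<bullet> (p - (p + a *\<^sub>R q)))) *\<^sub>R w) \<bullet> q = 1 / a"
    using a by (auto simp: field_simps)
  fix z assume "z \<in> C"
  then have "w \<bullet> (z - (p + a *\<^sub>R q)) \<le> 0"
    using w(2) unfolding normal_cone_def by blast
  then have "w \<bullet> (z - p) \<le> w \<bullet> (a *\<^sub>R q)"
    by (simp add: algebra_simps)
  then have "(w \<bullet> (z - p)) / (w \<bullet> (a *\<^sub>R q)) \<le> 1"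
    using pos by simp
  then show "((- 1 / (w \<bullet> (p - (p + a *\<^sub>R q)))) *\<^sub>R w) \<bullet> (z - p) \<le> 1"
    by simp
qed

text \<open>Test with the point of the sphere in the direction of \<open>v\<close>.\<close>

lemma norm_le_of_inner_le_on_cball:
  fixes v :: "'a::real_inner"
  assumes r: "r > 0" and le: "\<And>q. q \<in> cball p r \<Longrightarrow> v \<bullet> (q - p) \<le> 1"
  shows "norm v \<le> 1 / r"
proof (cases "v = 0")
  case False
  have "v \<bullet> ((p + (r / norm v) *\<^sub>R v) - p) \<le> 1"
    using r False by (intro le) (simp add: dist_norm)
  then have "r * norm v \<le> 1"
    using False by (simp add: dot_square_norm power2_eq_square)
  then show ?thesis
    using r by (simp add: field_simps)
qed (use r in simp)

text \<open>This is the shape of the line search: either supremum may be infinite, but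
  \<open>T\<close> and \<open>U\<close> are intervals around a common point, so the smaller supremum
  is the maximum of their bounded intersection.\<close>

lemma min_SUP_closed_convex:
  fixes T U :: "real set"
  assumes T: "closed T" "convex T" "0 \<in> T" and U: "closed U" "convex U" "0 \<in> U"
    and pos: "c > 0" "c \<in> T" "c \<in> U" and bound: "\<And>a. a \<in> T \<Longrightarrow> a \<in> U \<Longrightarrow> a \<le> B"
  obtains a where "min (SUP a\<in>T. ereal a) (SUP a\<in>U. ereal a) = ereal a"
    "a > 0" "a \<in> T" "a \<in> U" "\<And>d. d \<in> T \<Longrightarrow> d \<in> U \<Longrightarrow> d \<le> a"
proof
  let ?a = "Sup (T \<inter> U)"
  have bdd: "bdd_above (T \<inter> U)"
    using bound by (auto intro!: bdd_aboveI)
  have mem: "?a \<in> T \<inter> U"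
    using T U bdd by (intro closed_contains_Sup) auto
  show upper: "d \<le> ?a" if "d \<in> T" "d \<in> U" for d
    using that bdd by (intro cSup_upper) auto
  show "?a \<in> T" "?a \<in> U"
    using mem by auto
  show pos_a: "?a > 0"
    using upper[OF pos(2,3)] pos(1) by linarith
  have down: "d \<in> X" if "convex X" "0 \<in> X" "s \<in> X" "0 \<le> d" "d \<le> s" for X :: "real set" and d s
    using that by (meson atLeastAtMost_iff mem_is_interval_1_I is_interval_convex_1)
  show "min (SUP a\<in>T. ereal a) (SUP a\<in>U. ereal a) = ereal ?a"
  proof (rule antisym)
    show "ereal ?a \<le> min (SUP a\<in>T. ereal a) (SUP a\<in>U. ereal a)"
      using mem by (auto intro!: SUP_upper)
    show "min (SUP a\<in>T. ereal a) (SUP a\<in>U. ereal a) \<le> ereal ?a"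
    proof (rule ccontr)
      assume "\<not> ?thesis"
      then have "ereal ?a < (SUP a\<in>T. ereal a)" "ereal ?a < (SUP a\<in>U. ereal a)"
        by (auto simp: not_le)
      then obtain s u where s: "s \<in> T" "?a < s" and u: "u \<in> U" "?a < u"
        by (auto simp: less_SUP_iff)
      \<comment> \<open>This number lies between 0 and \<open>s\<close> and between 0 and
        \<open>u\<close>, so both intervals contain it.\<close>
      have "min s u \<in> T" "min s u \<in> U"
        using pos_a s u by (auto intro!: down[OF T(2,3) s(1)] down[OF U(2,3) u(1)])
      then have "min s u \<le> ?a"
        by (rule upper)
      then show False
        using s u by linarith
    qed
  qed
qed

section \<open>The polyhedral problem\<close>

locale polyhedral_problem =
  fixes f :: "'a::euclidean_space \<Rightarrow> ereal"
    and S :: "'a set"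
    and A :: "'a \<Rightarrow> 'b::euclidean_space"
    and b :: 'b
    and e :: 'a
    and fhat fstar :: real
  assumes f_proper: "\<And>x. f x \<noteq> - \<infinity>"
    and A_linear: "linear A"
    and e_interior: "e \<in> interior (S \<inter> edom f)"
    and e_eq: "A e = b"
    and sublevel_bounded: "bounded {x \<in> Feas S A b. f x \<le> f e}"
    and fstar: "ereal fstar = (INF x\<in>Feas S A b. f x)"
    and fhat: "ereal fhat > f e"
    and S_polyhedral: "polyhedron S"
    and f_piecewise_linear: "polyhedron (epi f)"
begin

definition K :: "('a \<times> real) set" where
  "K = epi f \<inter> fst -` S"

text \<open>These are the optimal solutions: a feasible point of value at most \<open>fstar\<close>,
  the infimum, has value \<open>fstar\<close>.\<close>

definition sols :: "'a set" where
  "sols = {y. A y = b \<and> (y, fstar) \<in> K}"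

lemma mem_epi: "(x, t) \<in> epi f \<longleftrightarrow> f x \<le> ereal t"
  unfolding epi_def edom_def by (auto intro: le_less_trans)

lemma mem_K: "(x, t) \<in> K \<longleftrightarrow> x \<in> S \<and> f x \<le> ereal t"
  unfolding K_def by (auto simp: mem_epi)

lemma polyhedron_K: "polyhedron K"
  unfolding K_def
  by (intro polyhedron_Int f_piecewise_linear polyhedron_linear_vimage S_polyhedral linear_fst)

lemma K_lower: "fstar \<le> t" if "(x, t) \<in> K" "A x = b"
proof -
  have "ereal fstar \<le> f x"
    unfolding fstar using that by (intro INF_lower) (auto simp: Feas_def mem_K)
  then show ?thesis
    using that by (metis mem_K ereal_less_eq(3) order_trans)
qed

lemma e_mem: "e \<in> interior S" "e \<in> interior (edom f)" "e \<in> S"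
  using e_interior interior_subset by (auto simp: interior_Int)

lemma f_e: "f e = ereal (real_of_ereal (f e))" "real_of_ereal (f e) < fhat" "fstar \<le> real_of_ereal (f e)"
proof -
  show 1: "f e = ereal (real_of_ereal (f e))"
    using f_proper[of e] fhat by (cases "f e") auto
  show "real_of_ereal (f e) < fhat"
    using fhat 1 by (metis less_ereal.simps(1))
  show "fstar \<le> real_of_ereal (f e)"
    using 1 by (intro K_lower[of e]) (auto simp: mem_K e_mem e_eq)
qed

lemma gap_pos: "fstar < fhat"
  using f_e by linarith

text \<open>A constraint of \<open>epi f\<close> that is active at \<open>(e, fhat)\<close> would have to be vertical, because
  the point lies strictly above the graph, and so would bound the domain of \<open>f\<close> at \<open>e\<close>.\<close>

lemma centre_interior_epi: "(e, fhat) \<in> interior (epi f)"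
proof -
  obtain F where F: "finite F" "epi f = \<Inter>F" "\<And>H. H \<in> F \<Longrightarrow> \<exists>a c. a \<noteq> 0 \<and> H = {x. a \<bullet> x \<le> c}"
    using f_piecewise_linear unfolding polyhedron_def by metis
  have "(e, fhat) \<in> interior H" if "H \<in> F" for H
  proof -
    obtain a c where a: "a \<noteq> 0" and H: "H = {x. a \<bullet> x \<le> c}"
      using F(3) \<open>H \<in> F\<close> by blast
    obtain v d where vd: "a = (v, d)"
      by (cases a)
    have sub: "v \<bullet> x + d * t \<le> c" if "f x \<le> ereal t" for x t
      using that F(2) \<open>H \<in> F\<close> H by (auto simp: vd simp flip: mem_epi)
    have "a \<bullet> (e, fhat) < c"
    proof (rule ccontr)
      assume "\<not> ?thesis"
      then have c: "c \<le> v \<bullet> e + d * fhat"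
        by (simp add: vd)
      \<comment> \<open>The points of the epigraph below and above \<open>(e, fhat)\<close> on the
        same vertical line force \<open>d\<close> to be 0.\<close>
      have "v \<bullet> e + d * real_of_ereal (f e) \<le> c"
        using f_e(1) by (intro sub) simp
      then have "d * (fhat - real_of_ereal (f e)) \<ge> 0"
        using c by (simp add: algebra_simps)
      then have "d \<ge> 0"
        using f_e(2) by (simp add: zero_le_mult_iff)
      moreover have "v \<bullet> e + d * (fhat + 1) \<le> c"
        using fhat by (intro sub) (metis ereal_less_eq(3) less_add_one less_imp_le order_trans)
      then have "d \<le> 0"
        using c by (simp add: algebra_simps)
      ultimately have d: "d = 0"
        by simp
      then have "v \<noteq> 0"
        using a vd by (auto simp: zero_prod_def)
      moreover have "v \<in> normal_cone (edom f) e"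
        unfolding normal_cone_def
      proof clarify
        fix q assume "q \<in> edom f"
        then have "f q \<le> ereal (real_of_ereal (f q))"
          using f_proper[of q] by (cases "f q") (auto simp: edom_def)
        then show "v \<bullet> (q - e) \<le> 0"
          using sub[of q "real_of_ereal (f q)"] c d by (simp add: inner_diff_right)
      qed
      ultimately have "v \<bullet> (e - e) < 0"
        using e_mem(2) by (intro inner_neg_of_interior)
      then show False
        by simp
    qed
    then have "(e, fhat) \<in> {x. a \<bullet> x < c}"
      by simp
    then show ?thesis
      using H by (intro interiorI[OF open_halfspace_lt]) auto
  qed
  moreover have "open (\<Inter>H\<in>F. interior H)"
    using F(1) by blast
  moreover have "(\<Inter>H\<in>F. interior H) \<subseteq> epi f"
    using F(2) interior_subset by blast
  ultimately show ?thesis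
    by (intro interiorI[of "\<Inter>H\<in>F. interior H"]) auto
qed

lemma ball_in_K:
  obtains r where "r > 0" "cball (e, fhat) r \<subseteq> K"
proof -
  have "(e, fhat) \<in> interior (epi f) \<inter> (interior S \<times> UNIV)"
    using centre_interior_epi e_mem(1) by simp
  moreover have "open (interior (epi f) \<inter> (interior S \<times> (UNIV :: real set)))"
    by (intro open_Int open_Times open_interior open_UNIV)
  moreover have "interior (epi f) \<inter> (interior S \<times> UNIV) \<subseteq> K"
    unfolding K_def using interior_subset[of S] interior_subset[of "epi f"] by auto
  ultimately show ?thesis
    using that by (metis open_contains_cball order_trans)
qed

section \<open>Existence of optimal solutions\<close>

text \<open>The height is minimised over the slice \<open>L\<close>, which is compact because the
  sublevel set is bounded and heights lie between \<open>fstar\<close> and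
  \<open>f e\<close>.\<close>

lemma sols_nonempty: "sols \<noteq> {}"
proof -
  let ?m = "real_of_ereal (f e)"
  define L where "L = K \<inter> {p. A (fst p) = b} \<inter> {p. snd p \<le> ?m}"
  have "continuous_on UNIV (\<lambda>p::'a \<times> real. A (fst p))"
    using linear_continuous_on_compose[OF continuous_on_fst[OF continuous_on_id[of UNIV]] A_linear] by simp
  then have "closed {p::'a \<times> real. A (fst p) = b}"
    by (intro closed_Collect_eq continuous_intros)
  moreover have "closed {p::'a \<times> real. snd p \<le> ?m}"
    by (intro closed_Collect_le continuous_intros)
  ultimately have "closed L"
    unfolding L_def using polyhedron_imp_closed[OF polyhedron_K] by blast
  moreover have "L \<subseteq> {x \<in> Feas S A b. f x \<le> f e} \<times> {fstar..?m}"
  proof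
    fix p assume p: "p \<in> L"
    obtain x t where xt: "p = (x, t)"
      by (cases p)
    have "f x \<le> ereal t" "t \<le> ?m"
      using p by (auto simp: L_def xt mem_K)
    then have "f x \<le> f e"
      using f_e(1) by (metis ereal_less_eq(3) order_trans)
    then show "p \<in> {x \<in> Feas S A b. f x \<le> f e} \<times> {fstar..?m}"
      using p by (auto simp: L_def xt mem_K Feas_def intro: K_lower)
  qed
  then have "bounded L"
    by (rule bounded_subset[rotated]) (intro bounded_Times sublevel_bounded bounded_closed_interval)
  ultimately have "compact L"
    by (simp add: compact_eq_bounded_closed)
  moreover have eL: "(e, ?m) \<in> L"
    using f_e(1) by (simp add: L_def mem_K e_mem e_eq)
  ultimately obtain p where p: "p \<in> L" "\<And>q. q \<in> L \<Longrightarrow> snd p \<le> snd q"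
    using continuous_attains_inf[of L snd] continuous_on_snd[OF continuous_on_id] by blast
  obtain y t where yt: "p = (y, t)"
    by (cases p)
  \<comment> \<open>The minimal height bounds \<open>f\<close> below on all of \<open>Feas\<close>,
    so it is at most \<open>fstar\<close>; points of value above \<open>f e\<close> cannot compete
    with \<open>e\<close> itself.\<close>
  have "ereal t \<le> f x" if x: "x \<in> Feas S A b" for x
  proof (cases "f x \<le> f e")
    case True
    then have fx: "f x = ereal (real_of_ereal (f x))"
      using f_proper[of x] f_e(1) by (cases "f x"; cases "f e") auto
    then have "(x, real_of_ereal (f x)) \<in> L"
      using x True f_e(1) unfolding L_def
      by (auto simp: mem_K Feas_def) (metis ereal_less_eq(3))
    then have "t \<le> real_of_ereal (f x)"
      using p(2) yt by fastforce
    then show ?thesis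
      using fx by (metis ereal_less_eq(3))
  next
    case False
    then have "ereal ?m \<le> f x"
      using f_e(1) by simp
    moreover have "t \<le> ?m"
      using p(2)[OF eL] yt by simp
    ultimately show ?thesis
      by (metis ereal_less_eq(3) order_trans)
  qed
  then have "ereal t \<le> ereal fstar"
    unfolding fstar by (intro INF_greatest)
  then have "f y \<le> ereal fstar"
    using p(1) by (auto simp: L_def yt mem_K intro: order_trans)
  then have "y \<in> sols"
    using p(1) by (auto simp: L_def yt mem_K sols_def)
  then show ?thesis
    by blast
qed

lemma closed_sols: "closed sols"
proof -
  have "sols = {y. A y = b} \<inter> (\<lambda>y. (y, fstar)) -` K"
    unfolding sols_def by auto
  moreover have "closed {y. A y = b}"
    by (intro closed_Collect_eq linear_continuous_on_compose[OF continuous_on_id A_linear] continuous_on_const)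
  moreover have "closed ((\<lambda>y. (y, fstar)) -` K)"
    by (intro closed_vimage polyhedron_imp_closed polyhedron_K continuous_intros)
  ultimately show ?thesis
    by auto
qed

section \<open>The line search\<close>

text \<open>So \<open>alpha\<close> is the last parameter at which the ray from
  \<open>(e, fhat)\<close> through \<open>(x, fstar)\<close> is in \<open>K\<close>, the reciprocal
  of the gauge.\<close>

lemma alpha_props:
  assumes x: "A x = b"
  defines "a \<equiv> alpha S f e fhat x fstar"
  shows "a > 0" "a \<le> 1" "(e + a *\<^sub>R (x - e), fhat + a * (fstar - fhat)) \<in> K"
    "\<And>d. (e + d *\<^sub>R (x - e), fhat + d * (fstar - fhat)) \<in> K \<Longrightarrow> d \<le> a"
proof -
  let ?T = "{a::real. e + a *\<^sub>R (x - e) \<in> S}"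
  let ?U = "{a::real. f (e + a *\<^sub>R (x - e)) \<le> ereal (fhat + a * (fstar - fhat))}"
  have in_K: "d \<in> ?T \<and> d \<in> ?U \<longleftrightarrow> (e + d *\<^sub>R (x - e), fhat + d * (fstar - fhat)) \<in> K" for d
    by (simp add: mem_K)
  have A_line: "A (e + d *\<^sub>R (x - e)) = b" for d
    using x e_eq A_linear by (simp add: linear_add linear_scale linear_diff)
  \<comment> \<open>Beyond parameter 1 the ray is lower than \<open>fstar\<close>, where
    \<open>K\<close> has no feasible points.\<close>
  have bound: "d \<le> 1" if "d \<in> ?T" "d \<in> ?U" for d
  proof -
    have "fstar \<le> fhat + d * (fstar - fhat)"
      using that in_K A_line by (blast intro: K_lower)
    then have "(d - 1) * (fhat - fstar) \<le> 0"
      by (simp add: algebra_simps)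
    then show ?thesis
      using gap_pos by (simp add: mult_le_0_iff)
  qed
  have vimage_line: "closed {a::real. p + a *\<^sub>R w \<in> C} \<and> convex {a::real. p + a *\<^sub>R w \<in> C}"
    if "polyhedron C" for C and p w :: "'c::euclidean_space"
  proof -
    \<comment> \<open>Translating the set makes the parametrisation linear.\<close>
    have *: "{a::real. p + a *\<^sub>R w \<in> C} = (\<lambda>a. a *\<^sub>R w) -` ((\<lambda>q. q - p) ` C)"
      by (force simp: image_iff algebra_simps)
    have "closed ((\<lambda>a::real. p + a *\<^sub>R w) -` C)"
      using that by (intro closed_vimage polyhedron_imp_closed continuous_intros)
    moreover have "convex {a::real. p + a *\<^sub>R w \<in> C}"
      unfolding * using that
      by (intro convex_linear_vimage convex_translation_subtract polyhedron_imp_convex)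
         (auto intro!: linearI simp: algebra_simps)
    ultimately show ?thesis
      by (simp add: vimage_def)
  qed
  have T: "closed ?T" "convex ?T"
    using vimage_line[OF S_polyhedral] by auto
  have "?U = {a. (e, fhat) + a *\<^sub>R (x - e, fstar - fhat) \<in> epi f}"
    by (simp add: mem_epi)
  then have U: "closed ?U" "convex ?U"
    using vimage_line[OF f_piecewise_linear] by auto
  obtain r where r: "r > 0" "cball (e, fhat) r \<subseteq> K"
    by (rule ball_in_K)
  let ?w = "(x - e, fstar - fhat)"
  \<comment> \<open>So small that \<open>c *\<^sub>R ?w\<close> has norm at most \<open>r\<close>;
    the summand 1 keeps the denominator positive.\<close>
  define c where "c = r / (1 + norm ?w)"
  have c: "c > 0"
    using r(1) by (simp add: c_def add_pos_nonneg)
  have "c * norm ?w \<le> c * (1 + norm ?w)"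
    using c by (intro mult_left_mono) auto
  also have "\<dots> = r"
    by (simp add: c_def add_pos_nonneg[THEN less_imp_neq, symmetric])
  finally have "(e, fhat) + c *\<^sub>R ?w \<in> cball (e, fhat) r"
    using c by (simp only: mem_cball dist_norm) (simp del: scaleR_Pair)
  then have "(e, fhat) + c *\<^sub>R ?w \<in> K"
    using r(2) by blast
  then have cTU: "c \<in> ?T" "c \<in> ?U"
    using in_K[of c] by auto
  have 0: "0 \<in> ?T" "0 \<in> ?U"
    using e_mem(3) fhat by auto
  obtain a' where a': "min (SUP a\<in>?T. ereal a) (SUP a\<in>?U. ereal a) = ereal a'"
    "a' > 0" "a' \<in> ?T" "a' \<in> ?U" "\<And>d. d \<in> ?T \<Longrightarrow> d \<in> ?U \<Longrightarrow> d \<le> a'"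
    using min_SUP_closed_convex[OF T 0(1) U 0(2) c cTU bound] by blast
  have "a = a'"
    unfolding a_def alpha_def alpha1_def alpha2_def a'(1) by simp
  then show "a > 0" "a \<le> 1" "(e + a *\<^sub>R (x - e), fhat + a * (fstar - fhat)) \<in> K"
    "\<And>d. (e + d *\<^sub>R (x - e), fhat + d * (fstar - fhat)) \<in> K \<Longrightarrow> d \<le> a"
    using a' bound in_K by blast+
qed

text \<open>The algorithm sets \<open>(x' 0, t' 0)\<close> by hand. The vertical ray down from
  \<open>(e, fhat)\<close> leaves \<open>K\<close> at \<open>(e, f e)\<close>, so the starting point
  is a radial projection like all later ones.\<close>

lemma alpha_centre: "fhat + alpha S f e fhat e fstar * (fstar - fhat) = real_of_ereal (f e)"
proof (rule antisym)
  let ?a = "alpha S f e fhat e fstar" and ?m = "real_of_ereal (f e)"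
  have "f e \<le> ereal (fhat + ?a * (fstar - fhat))"
    using alpha_props(3)[OF e_eq] by (simp add: mem_K)
  then show "?m \<le> fhat + ?a * (fstar - fhat)"
    using f_e(1) by (metis ereal_less_eq(3))
  \<comment> \<open>The parameter at which the vertical ray reaches height
    \<open>f e\<close>.\<close>
  let ?d = "(fhat - ?m) / (fhat - fstar)"
  have d: "?d * (fstar - fhat) = ?m - fhat"
    using gap_pos by (simp add: field_simps)
  have "?d \<le> ?a"
    using f_e(1) by (intro alpha_props(4)[OF e_eq]) (simp add: d mem_K e_mem del: times_divide_eq_left)
  then have "?a * (fstar - fhat) \<le> ?d * (fstar - fhat)"
    using gap_pos by (intro mult_right_mono_neg) auto
  then show "fhat + ?a * (fstar - fhat) \<le> ?m"
    using d by linarith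
qed

section \<open>Elements of \<open>G\<close> as bounded subgradients\<close>

text \<open>The second part is the subgradient inequality at \<open>x\<close> for the gauge, whose
  value is \<open>1 / a\<close> at \<open>x\<close> and at most 1 at a solution.\<close>

lemma G_props:
  assumes r: "r > 0" "cball (e, fhat) r \<subseteq> K" and a: "a > 0"
    and g: "g \<in> G S f e fhat (e + a *\<^sub>R (x - e)) (fhat + a * (fstar - fhat))"
  shows "norm g \<le> 1 / r" "\<And>y. y \<in> sols \<Longrightarrow> g \<bullet> (y - x) \<le> 1 - 1 / a"
proof -
  let ?x = "e + a *\<^sub>R (x - e)" and ?t = "fhat + a * (fstar - fhat)"
  \<comment> \<open>Both claims are convex conditions on \<open>g\<close>, so they need checking
    only on \<open>G1\<close> and \<open>G2\<close> and then extend to the hull.\<close>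
  define good where "good = cball 0 (1 / r) \<inter> (\<Inter>y\<in>sols. {g. (y - x) \<bullet> g \<le> 1 - 1 / a})"
  have ball: "(q, fhat) \<in> K" if "q \<in> cball e r" for q
    using that by (intro subsetD[OF r(2)]) (simp add: dist_Pair_Pair)
  have "G1 S e ?x \<subseteq> good"
  proof
    fix g assume "g \<in> G1 S e ?x"
    then obtain v where v: "v \<noteq> 0" "v \<in> normal_cone S ?x" and g: "g = (- 1 / (v \<bullet> (e - ?x))) *\<^sub>R v"
      unfolding G1_def by blast
    note * = scaled_normal[OF e_mem(1) v a, folded g]
    have "norm g \<le> 1 / r"
      using ball by (intro norm_le_of_inner_le_on_cball[OF r(1), of e] *(2)) (auto simp: mem_K)
    moreover have "g \<bullet> (y - x) \<le> 1 - 1 / a" if "y \<in> sols" for y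
    proof -
      have "g \<bullet> (y - e) \<le> 1"
        using that by (intro *(2)) (auto simp: sols_def mem_K)
      then show ?thesis
        using *(1) by (simp add: inner_diff_right)
    qed
    ultimately show "g \<in> good"
      by (simp add: good_def inner_commute)
  qed
  moreover have "G2 f e fhat ?x ?t \<subseteq> good"
  proof
    fix g assume "g \<in> G2 f e fhat ?x ?t"
    then obtain v d where vd: "(v, d) \<noteq> (0, 0)" "(v, d) \<in> normal_cone (epi f) (?x, ?t)"
      and g: "g = (- 1 / (v \<bullet> (e - ?x) + (fhat - ?t) * d)) *\<^sub>R v"
      unfolding G2_def by blast
    define s where "s = - 1 / ((v, d) \<bullet> ((e, fhat) - ((e, fhat) + a *\<^sub>R (x - e, fstar - fhat))))"
    have gs: "s *\<^sub>R (v, d) = (g, s * d)"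
      unfolding g s_def by (simp add: mult.commute)
    have vd': "(v, d) \<noteq> 0" "(v, d) \<in> normal_cone (epi f) ((e, fhat) + a *\<^sub>R (x - e, fstar - fhat))"
      using vd by (auto simp: zero_prod_def)
    note * = scaled_normal[OF centre_interior_epi vd' a, folded s_def, unfolded gs]
    \<comment> \<open>The vertical term vanishes at height \<open>fhat\<close>, which gives the norm
      bound, and at height \<open>fstar\<close> it cancels against the one in \<open>*(1)\<close>,
      which gives the subgradient inequality.\<close>
    have le: "g \<bullet> (z - e) + (s * d) * (t - fhat) \<le> 1" if "f z \<le> ereal t" for z t
      using *(2)[of "(z, t)"] that by (simp add: mem_epi)
    have "norm g \<le> 1 / r"
    proof (rule norm_le_of_inner_le_on_cball[OF r(1)])
      fix q assume "q \<in> cball e r"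
      then show "g \<bullet> (q - e) \<le> 1"
        using le[of q fhat] ball by (simp add: mem_K)
    qed
    moreover have "g \<bullet> (y - x) \<le> 1 - 1 / a" if "y \<in> sols" for y
      using *(1) le[of y fstar] that by (simp add: inner_diff_right sols_def mem_K)
    ultimately show "g \<in> good"
      by (simp add: good_def inner_commute)
  qed
  moreover have "convex good"
    unfolding good_def by (intro convex_Int convex_cball convex_INT convex_halfspace_le)
  ultimately have hull: "convex hull (G1 S e ?x \<union> G2 f e fhat ?x ?t) \<subseteq> good"
    by (intro hull_minimal) auto
  have "G S f e fhat ?x ?t \<subseteq> convex hull (G1 S e ?x \<union> G2 f e fhat ?x ?t)"
    using hull_subset[of "G1 S e ?x \<union> G2 f e fhat ?x ?t" convex] unfolding G_def by (simp split: if_split)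
  then have "g \<in> good"
    using g hull by blast
  then show "norm g \<le> 1 / r" "\<And>y. y \<in> sols \<Longrightarrow> g \<bullet> (y - x) \<le> 1 - 1 / a"
    by (auto simp: good_def inner_commute)
qed

section \<open>Linear growth of the gauge\<close>

text \<open>Apply \<open>polytope_linear_sharp_min\<close> to the height on a bounded piece of
  \<open>K\<close>. The projected point has height gap \<open>(1 - a) * (fhat - fstar)\<close> and
  differs from \<open>x\<close> by \<open>(1 - a) *\<^sub>R (x - e)\<close>, so both errors are of
  order \<open>1 - a\<close>.\<close>

lemma gauge_sharp:
  obtains C where "C > 0"
    "\<And>x a. A x = b \<Longrightarrow> norm (x - e) \<le> R \<Longrightarrow> 0 < a \<Longrightarrow> a \<le> 1 \<Longrightarrow>
      (e + a *\<^sub>R (x - e), fhat + a * (fstar - fhat)) \<in> K \<Longrightarrow>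
      \<exists>y\<in>sols. norm (x - y) \<le> C * (1 / a - 1)"
proof -
  obtain z where z: "z \<in> sols"
    using sols_nonempty by blast
  \<comment> \<open>The box must contain \<open>z\<close>, so that height \<open>fstar\<close> is
    attained in \<open>Q\<close>, and the ball, so that all projected points are in
    \<open>Q\<close>.\<close>
  obtain c d where cd: "insert z (cball e R) \<subseteq> cbox c d"
    using bounded_subset_cbox_symmetric[of "insert z (cball e R)"] by (metis bounded_cball bounded_insert)
  define Q where "Q = K \<inter> fst -` (A -` {b}) \<inter> cbox (c, fstar) (d, fhat)"
  have mem_Q: "(x, t) \<in> Q \<longleftrightarrow> (x, t) \<in> K \<and> A x = b \<and> x \<in> cbox c d \<and> fstar \<le> t \<and> t \<le> fhat" for x t
    unfolding Q_def by auto
  have "polyhedron Q"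
    unfolding Q_def
    by (intro polyhedron_Int polyhedron_K polyhedron_linear_vimage linear_fst A_linear polyhedron_interval
        affine_imp_polyhedron affine_sing)
  moreover have "bounded Q"
    unfolding Q_def by (intro bounded_Int) auto
  ultimately have Q: "polytope Q"
    by (simp add: polytope_eq_bounded_polyhedron)
  have lower: "fstar \<le> (0, 1) \<bullet> q" if "q \<in> Q" for q :: "'a \<times> real"
    using that by (cases q) (auto simp: mem_Q)
  have zQ: "(z, fstar) \<in> Q"
    using z cd gap_pos by (auto simp: mem_Q sols_def)
  obtain C where C: "C \<ge> 0"
    "\<And>q. q \<in> Q \<Longrightarrow> \<exists>y\<in>Q. (0, 1) \<bullet> y = fstar \<and> norm (q - y) \<le> C * ((0, 1) \<bullet> q - fstar)"
    using polytope_linear_sharp_min[OF Q lower zQ] by auto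
  \<comment> \<open>In the constant, \<open>\<bar>R\<bar>\<close> pays for the radial move, the
    second term for the distance within \<open>Q\<close>, and 1 makes it positive.\<close>
  have bound: "\<exists>y\<in>sols. norm (x - y) \<le> (\<bar>R\<bar> + C * (fhat - fstar) + 1) * (1 / a - 1)"
    if x: "A x = b" "norm (x - e) \<le> R" and a: "0 < a" "a \<le> 1"
      and K: "(e + a *\<^sub>R (x - e), fhat + a * (fstar - fhat)) \<in> K" for x a
  proof -
    let ?x = "e + a *\<^sub>R (x - e)" and ?t = "fhat + a * (fstar - fhat)"
    have gap: "?t - fstar = (1 - a) * (fhat - fstar)"
      by (simp add: algebra_simps)
    have "a * norm (x - e) \<le> 1 * R"
      using x(2) a by (intro mult_mono) auto
    then have "?x \<in> cball e R"
      using a by (simp add: dist_norm)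
    moreover have "A ?x = b"
      using x e_eq A_linear by (simp add: linear_add linear_scale linear_diff)
    moreover have "fstar \<le> ?t" "?t \<le> fhat"
      using gap a gap_pos mult_nonneg_nonneg[of "1 - a" "fhat - fstar"] mult_nonneg_nonpos[of a "fstar - fhat"]
      by linarith+
    ultimately have "(?x, ?t) \<in> Q"
      using K cd by (auto simp: mem_Q)
    then obtain p where p: "p \<in> Q" "(0, 1) \<bullet> p = fstar"
      "norm ((?x, ?t) - p) \<le> C * ((0, 1) \<bullet> (?x, ?t) - fstar)"
      using C(2) by blast
    obtain y where y: "p = (y, fstar)"
      using p(2) by (cases p) auto
    have "norm (x - y) \<le> norm (x - ?x) + norm (?x - y)"
      using norm_triangle_ineq[of "x - ?x" "?x - y"] by simp
    also have "x - ?x = (1 - a) *\<^sub>R (x - e)"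
      by (simp add: algebra_simps)
    also have "norm \<dots> \<le> (1 - a) * \<bar>R\<bar>"
      using x(2) a by (auto intro: mult_left_mono)
    also have "norm (?x - y) \<le> norm ((?x, ?t) - p)"
      unfolding y by (metis diff_Pair norm_fst_le)
    also have "\<dots> \<le> C * ((1 - a) * (fhat - fstar))"
      using p(3) gap by simp
    also have "(1 - a) * \<bar>R\<bar> + C * ((1 - a) * (fhat - fstar)) \<le> (\<bar>R\<bar> + C * (fhat - fstar) + 1) * (1 - a)"
      using a by (simp add: algebra_simps)
    also have "\<dots> \<le> (\<bar>R\<bar> + C * (fhat - fstar) + 1) * (1 / a - 1)"
    proof (rule mult_left_mono)
      have "(1 - a) * 1 \<le> (1 - a) * (1 / a)"
        using a by (intro mult_left_mono) (auto simp: field_simps)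
      then show "1 - a \<le> 1 / a - 1"
        using a by (simp add: field_simps)
      show "0 \<le> \<bar>R\<bar> + C * (fhat - fstar) + 1"
        using C(1) gap_pos by simp
    qed
    finally have "norm (x - y) \<le> (\<bar>R\<bar> + C * (fhat - fstar) + 1) * (1 / a - 1)"
      by simp
    moreover have "y \<in> sols"
      using p(1) by (auto simp: y mem_Q sols_def)
    ultimately show ?thesis
      by blast
  qed
  have "\<bar>R\<bar> + C * (fhat - fstar) + 1 > 0"
    using C(1) gap_pos by (simp add: add_nonneg_pos)
  then show ?thesis
    using bound by (rule that)
qed

section \<open>Polyak's method and its rate\<close>

text \<open>Steps lie in the kernel of \<open>A\<close>, so iterates stay on the affine space;
  \<open>alpha_centre\<close> makes the formulas hold at \<open>k = 0\<close> too.\<close>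

lemma algorithm_invariants:
  assumes "algorithm_B S f A e fhat fstar x x' t' al g"
  shows "A (x k) = b" "al k = alpha S f e fhat (x k) fstar"
    "x' k = e + al k *\<^sub>R (x k - e)" "t' k = fhat + al k * (fstar - fhat)"
    "g k \<in> G S f e fhat (x' k) (t' k)"
proof -
  let ?V = "{z. A z = 0}"
  have init: "x 0 = e" "x' 0 = e" "ereal (t' 0) = f e" "al 0 = alpha S f e fhat (x 0) fstar"
    and g: "\<And>k. g k \<in> G S f e fhat (x' k) (t' k)"
    and x_Suc: "\<And>k. x (Suc k) = (let p = orth_proj ?V (g k) in
             if p = 0 then x k else x k + ((al k - 1) / (al k * (norm p)\<^sup>2)) *\<^sub>R p)"
    and x'_Suc: "\<And>k. (x' (Suc k), t' (Suc k)) = radial_proj S f e fhat (x (Suc k)) fstar"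
    and al_Suc: "\<And>k. al (Suc k) = alpha S f e fhat (x (Suc k)) fstar"
    using assms unfolding algorithm_B_def Let_def by auto
  show al: "al k = alpha S f e fhat (x k) fstar" for k
    using init(4) al_Suc by (cases k) auto
  show "x' k = e + al k *\<^sub>R (x k - e)" "t' k = fhat + al k * (fstar - fhat)" for k
  proof (atomize (full), cases k)
    case 0
    have "t' 0 = real_of_ereal (f e)"
      using init(3) by (metis real_of_ereal.simps(1))
    then show "x' k = e + al k *\<^sub>R (x k - e) \<and> t' k = fhat + al k * (fstar - fhat)"
      using 0 init alpha_centre by simp
  next
    case (Suc m)
    show "x' k = e + al k *\<^sub>R (x k - e) \<and> t' k = fhat + al k * (fstar - fhat)"
      using x'_Suc[of m] al_Suc[of m] unfolding Suc radial_proj_def by simp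
  qed
  have "orth_proj ?V (g k) \<in> ?V" for k
    by (intro orth_proj_subspace linear_subspace_kernel A_linear)
  then show "A (x k) = b" for k
    using A_linear init(1) e_eq by (induction k) (simp_all add: x_Suc Let_def linear_add linear_scale)
  show "g k \<in> G S f e fhat (x' k) (t' k)"
    by (rule g)
qed

text \<open>Expand the square after a step of length \<open>h / norm p\<close>, where
  \<open>h\<close> is the excess of the gauge over its minimum 1. The second bound is
  Cauchy-Schwarz.\<close>

lemma Polyak_step:
  assumes alg: "algorithm_B S f A e fhat fstar x x' t' al g"
    and r: "r > 0" "cball (e, fhat) r \<subseteq> K" and y: "y \<in> sols"
  shows "(norm (x (Suc k) - y))\<^sup>2 \<le> (norm (x k - y))\<^sup>2 - (r * (1 / al k - 1))\<^sup>2"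
    "r * (1 / al k - 1) \<le> norm (x k - y)"
proof -
  let ?V = "{z. A z = 0}"
  define p where "p = orth_proj ?V (g k)"
  define h where "h = 1 / al k - 1"
  note inv = algorithm_invariants[OF alg, of k]
  have al: "al k > 0" "al k \<le> 1"
    using alpha_props[OF inv(1)] inv(2) by auto
  have h: "h \<ge> 0"
    using al by (simp add: h_def)
  have V: "subspace ?V"
    by (intro linear_subspace_kernel A_linear)
  have g: "norm (g k) \<le> 1 / r" "g k \<bullet> (y - x k) \<le> 1 - 1 / al k"
    using G_props[OF r al(1), of "g k" "x k"] inv(3-5) y by auto
  have norm_p: "norm p \<le> 1 / r"
    using norm_orth_proj_le[OF V] g(1) unfolding p_def by (rule order_trans)
  have "x k - y \<in> ?V"
    using inv(1) y A_linear by (simp add: sols_def linear_diff)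
  \<comment> \<open>Since \<open>x k - y\<close> is in the kernel, the subgradient inequality
    survives the projection of \<open>g k\<close>.\<close>
  then have ph: "h \<le> p \<bullet> (x k - y)"
    using orth_proj_subspace(2)[OF V, of "x k - y" "g k"] g(2)
    unfolding p_def h_def by (simp add: inner_diff_right)
  also have "\<dots> \<le> norm p * norm (x k - y)"
    by (rule norm_cauchy_schwarz)
  also have "\<dots> \<le> 1 / r * norm (x k - y)"
    using norm_p by (intro mult_right_mono) auto
  finally show "r * (1 / al k - 1) \<le> norm (x k - y)"
    using r(1) by (simp add: h_def field_simps)
  show "(norm (x (Suc k) - y))\<^sup>2 \<le> (norm (x k - y))\<^sup>2 - (r * (1 / al k - 1))\<^sup>2"
  proof (cases "p = 0")
    case True
    \<comment> \<open>A vanishing projection means that \<open>x k\<close> is already optimal, so no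
      decrease is claimed.\<close>
    then have "h = 0"
      using ph h by simp
    moreover have "x (Suc k) = x k"
      using alg True unfolding algorithm_B_def p_def Let_def by simp
    ultimately show ?thesis
      by (simp add: h_def)
  next
    case False
    define s where "s = h / (norm p)\<^sup>2"
    have np: "norm p > 0"
      using False by simp
    have "x (Suc k) = x k + ((al k - 1) / (al k * (norm p)\<^sup>2)) *\<^sub>R p"
      using alg False unfolding algorithm_B_def p_def Let_def by simp
    also have "(al k - 1) / (al k * (norm p)\<^sup>2) = - s"
      using al np by (simp add: s_def h_def field_simps)
    finally have "x (Suc k) - y = (x k - y) - s *\<^sub>R p"
      by simp
    then have "(norm (x (Suc k) - y))\<^sup>2 = (norm (x k - y))\<^sup>2 - 2 * s * (p \<bullet> (x k - y)) + s\<^sup>2 * (norm p)\<^sup>2"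
      by (simp only: power2_norm_eq_inner) (simp add: algebra_simps inner_commute power2_eq_square)
    also have "s\<^sup>2 * (norm p)\<^sup>2 = s * h"
      using np by (simp add: s_def power2_eq_square)
    also have "(norm (x k - y))\<^sup>2 - 2 * s * (p \<bullet> (x k - y)) + s * h \<le> (norm (x k - y))\<^sup>2 - s * h"
      using ph h mult_left_mono[of h "p \<bullet> (x k - y)" s] by (auto simp: s_def)
    \<comment> \<open>Here \<open>s * h\<close> is the square of \<open>h / norm p\<close>, and
      \<open>norm p\<close> is at most \<open>1 / r\<close>.\<close>
    also have "\<dots> \<le> (norm (x k - y))\<^sup>2 - (r * h)\<^sup>2"
    proof -
      have "r * norm p \<le> 1"
        using norm_p r(1) by (simp add: field_simps)
      then have "(r * norm p)\<^sup>2 \<le> 1"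
        using r(1) by (simp add: power_le_one)
      then have "(r * norm p)\<^sup>2 * h\<^sup>2 \<le> 1 * h\<^sup>2"
        by (intro mult_right_mono) auto
      then show ?thesis
        using np by (simp add: s_def field_simps power2_eq_square)
    qed
    finally show ?thesis
      by (simp add: h_def)
  qed
qed

text \<open>Polyak's decrease, taken at the nearest solution and combined with
  \<open>gauge_sharp\<close>, contracts the distance to \<open>sols\<close>. The constants are fixed
  before the run.\<close>

lemma linear_convergence:
  obtains q M where "0 < q" "q < 1" "M > 0"
    "\<And>x x' t' al g k. algorithm_B S f A e fhat fstar x x' t' al g \<Longrightarrow> 1 - al k \<le> M * q ^ k"
proof -
  obtain r where r: "r > 0" "cball (e, fhat) r \<subseteq> K"
    by (rule ball_in_K)
  obtain z where z: "z \<in> sols"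
    using sols_nonempty by blast
  define D where "D = norm (e - z)"
  obtain C where C: "C > 0"
    "\<And>x a. A x = b \<Longrightarrow> norm (x - e) \<le> 2 * D \<Longrightarrow> 0 < a \<Longrightarrow> a \<le> 1 \<Longrightarrow>
      (e + a *\<^sub>R (x - e), fhat + a * (fstar - fhat)) \<in> K \<Longrightarrow>
      \<exists>y\<in>sols. norm (x - y) \<le> C * (1 / a - 1)"
    using gauge_sharp[of "2 * D"] by blast
  \<comment> \<open>Adding \<open>r\<close> puts \<open>r / B\<close> strictly between 0 and 1, so
    \<open>q\<close> is too.\<close>
  define B where "B = C + r"
  define q where "q = sqrt (1 - (r / B)\<^sup>2)"
  have rB: "0 < r / B" "r / B < 1" and B: "B > 0" "C \<le> B"
    using C(1) r(1) by (auto simp: B_def)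
  have "(r / B)\<^sup>2 < 1"
    using rB by (simp add: power_less_one_iff)
  moreover have "(r / B)\<^sup>2 > 0"
    using rB(1) by (rule zero_less_power)
  ultimately have q: "0 < q" "q < 1" "q\<^sup>2 = 1 - (r / B)\<^sup>2"
    by (auto simp: q_def)
  \<comment> \<open>With \<open>D + 1\<close> the factor is positive even if \<open>e\<close> is
    optimal and \<open>D = 0\<close>; its logarithm is needed later.\<close>
  have "1 - al k \<le> ((D + 1) / r) * q ^ k"
    if alg: "algorithm_B S f A e fhat fstar x x' t' al g" for x x' t' al g k
  proof -
    note inv = algorithm_invariants[OF alg]
    have al: "al k > 0" "al k \<le> 1" "(e + al k *\<^sub>R (x k - e), fhat + al k * (fstar - fhat)) \<in> K" for k
      using alpha_props[OF inv(1)] inv(2) by auto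
    have x0: "x 0 = e"
      using alg unfolding algorithm_B_def by simp
    \<comment> \<open>Distances to a fixed solution never increase, so the iterates stay in the ball
      of radius \<open>2 * D\<close> about \<open>e\<close> where the growth bound holds.\<close>
    have "norm (x k - z) \<le> D" for k
    proof (induction k)
      case (Suc k)
      have "(norm (x (Suc k) - z))\<^sup>2 \<le> (norm (x k - z))\<^sup>2"
        using Polyak_step(1)[OF alg r z, of k] by (smt (verit) zero_le_power2)
      then show ?case
        using Suc by (meson norm_ge_zero order_trans power2_le_imp_le)
    qed (simp add: x0 D_def)
    then have "norm (x k - e) \<le> 2 * D" for k
      using norm_triangle_ineq4[of "x k - z" "e - z"] by (smt (verit) D_def diff_diff_eq2 diff_add_cancel)
    then have sharp: "\<exists>y\<in>sols. norm (x k - y) \<le> C * (1 / al k - 1)" for k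
      using C(2) inv(1) al by blast
    have dist: "infdist (x k) sols \<le> D * q ^ k" for k
    proof (induction k)
      case 0
      then show ?case
        using infdist_le[OF z, of e] by (simp add: x0 D_def dist_norm)
    next
      case (Suc k)
      obtain y where y: "y \<in> sols" "infdist (x k) sols = norm (x k - y)"
        using infdist_attains_inf[OF closed_sols sols_nonempty] by (metis dist_norm)
      \<comment> \<open>The solution from the growth bound is no closer than the nearest one,
        \<open>y\<close>, so the bound holds for \<open>y\<close> as well.\<close>
      obtain y' where y': "y' \<in> sols" "norm (x k - y') \<le> C * (1 / al k - 1)"
        using sharp by blast
      have "norm (x k - y) \<le> norm (x k - y')"
        using infdist_le[OF y'(1), of "x k"] y(2) by (simp add: dist_norm)
      also have "\<dots> \<le> B * (1 / al k - 1)"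
        using y'(2) B(2) al[of k] by (smt (verit) mult_right_mono le_divide_eq_1_pos)
      finally have "(r / B) * norm (x k - y) \<le> (r / B) * (B * (1 / al k - 1))"
        using rB by (intro mult_left_mono) auto
      then have "(r / B) * norm (x k - y) \<le> r * (1 / al k - 1)"
        using B by simp
      then have "((r / B) * norm (x k - y))\<^sup>2 \<le> (r * (1 / al k - 1))\<^sup>2"
        by (rule power_mono) (use rB(1) in \<open>intro mult_nonneg_nonneg less_imp_le norm_ge_zero\<close>)
      moreover have "(q * norm (x k - y))\<^sup>2 = (norm (x k - y))\<^sup>2 - ((r / B) * norm (x k - y))\<^sup>2"
        by (simp only: power_mult_distrib q(3) left_diff_distrib mult_1_left)
      ultimately have "(norm (x (Suc k) - y))\<^sup>2 \<le> (q * norm (x k - y))\<^sup>2"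
        using Polyak_step(1)[OF alg r y(1), of k] by linarith
      then have "norm (x (Suc k) - y) \<le> q * norm (x k - y)"
        by (rule power2_le_imp_le) (use q(1) in simp)
      also have "\<dots> \<le> q * (D * q ^ k)"
        using Suc q(1) y(2) by (intro mult_left_mono) auto
      finally show ?case
        using infdist_le[OF y(1), of "x (Suc k)"] by (simp add: dist_norm mult_ac)
    qed
    obtain y where y: "y \<in> sols" "infdist (x k) sols = norm (x k - y)"
      using infdist_attains_inf[OF closed_sols sols_nonempty] by (metis dist_norm)
    have "r * (1 / al k - 1) \<le> (D + 1) * q ^ k"
      using Polyak_step(2)[OF alg r y(1), of k] dist[of k] y(2) q(1)
      by (smt (verit) mult_right_mono zero_le_power)
    then have "1 / al k - 1 \<le> ((D + 1) / r) * q ^ k"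
      using r(1) by (simp add: field_simps)
    moreover have "1 - al k \<le> 1 / al k - 1"
    proof -
      have "(1 - al k) * al k \<le> (1 - al k) * 1"
        using al[of k] by (intro mult_left_mono) auto
      then show ?thesis
        using al[of k] by (simp add: field_simps)
    qed
    ultimately show ?thesis
      by linarith
  qed
  moreover have "(D + 1) / r > 0"
    using r(1) by (simp add: D_def add_nonneg_pos)
  ultimately show ?thesis
    using q that by blast
qed

text \<open>The height \<open>t' k\<close> exceeds \<open>fstar\<close> by exactly the fraction
  \<open>1 - al k\<close> of the gap, and it bounds \<open>f (x' k)\<close>.\<close>

lemma feasible_gap:
  assumes alg: "algorithm_B S f A e fhat fstar x x' t' al g"
  shows "x' k \<in> Feas S A b" "(f (x' k) - ereal fstar) / ereal (fhat - fstar) \<le> ereal (1 - al k)"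
proof -
  note inv = algorithm_invariants[OF alg, of k]
  have K: "(x' k, t' k) \<in> K"
    using alpha_props(3)[OF inv(1)] inv by simp
  have "A (x' k) = b"
    using inv(1,3) e_eq A_linear by (simp add: linear_add linear_scale linear_diff)
  then show "x' k \<in> Feas S A b"
    using K by (simp add: Feas_def mem_K)
  obtain m where m: "f (x' k) = ereal m"
    using K f_proper[of "x' k"] by (cases "f (x' k)") (auto simp: mem_K)
  have "m - fstar \<le> (1 - al k) * (fhat - fstar)"
    using K inv(4) by (simp add: mem_K m algebra_simps)
  then show "(f (x' k) - ereal fstar) / ereal (fhat - fstar) \<le> ereal (1 - al k)"
    using gap_pos by (simp add: m divide_le_eq)
qed

end

theorem mainTheorem3:
  fixes f :: "'a::euclidean_space \<Rightarrow> ereal"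
    and S :: "'a set"
    and A :: "'a \<Rightarrow> 'b::euclidean_space"
    and b :: 'b
    and e :: 'a
    and fhat fstar :: real
  assumes f_proper: "\<And>x. f x \<noteq> - \<infinity>"
    and f_lsc: "lower_semicont f"
    and f_convex: "convex_ereal f"
    and S_closed: "closed S"
    and S_convex: "convex S"
    and S_interior: "interior S \<noteq> {}"
    and A_linear: "linear A"
    and e_interior: "e \<in> interior (S \<inter> edom f)"
    and e_eq: "A e = b"
    and sublevel_bounded: "bounded {x \<in> Feas S A b. f x \<le> f e}"
    and fstar: "ereal fstar = (INF x\<in>Feas S A b. f x)"
    and fhat: "ereal fhat > f e"
    and S_polyhedral: "polyhedron S"
    and f_piecewise_linear: "polyhedron (epi f)"
  shows "\<exists>C1 C2 :: real. \<forall>x x' t' al g.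
           algorithm_B S f A e fhat fstar x x' t' al g \<longrightarrow>
             (\<forall>k. x' k \<in> Feas S A b) \<and>
             (\<forall>\<epsilon>::real. \<forall>l::nat.
                0 < \<epsilon> \<and> \<epsilon> < 1 \<and> real l \<ge> C1 * ln (1 / \<epsilon>) + C2 \<longrightarrow>
                (MIN k\<in>{..l}. (f (x' k) - ereal fstar) / ereal (fhat - fstar)) \<le> ereal \<epsilon>)"
proof -
  interpret polyhedral_problem f S A b e fhat fstar
    by (rule polyhedral_problem.intro) fact+
  obtain q M where q: "0 < q" "q < 1" and M: "M > 0"
    and conv: "\<And>x x' t' al g k. algorithm_B S f A e fhat fstar x x' t' al g \<Longrightarrow> 1 - al k \<le> M * q ^ k"
    using linear_convergence by blast
  have lnq: "ln q < 0"
    using q by simp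
  \<comment> \<open>The two constants come from solving \<open>M * q ^ l \<le> \<epsilon>\<close>
    for \<open>l\<close> by logarithms; dividing by \<open>- ln q\<close> keeps the inequality's
    direction.\<close>
  have rate: "M * q ^ l \<le> \<epsilon>"
    if "0 < \<epsilon>" and l: "real l \<ge> (1 / - ln q) * ln (1 / \<epsilon>) + ln M / - ln q" for \<epsilon> :: real and l :: nat
  proof -
    have "(1 / - ln q) * ln (1 / \<epsilon>) + ln M / - ln q = (ln (1 / \<epsilon>) + ln M) / - ln q"
      by (simp add: add_divide_distrib)
    then have "ln (1 / \<epsilon>) + ln M \<le> real l * - ln q"
      using l lnq by (metis neg_0_less_iff_less pos_divide_le_eq)
    then have "ln M + real l * ln q \<le> ln \<epsilon>"
      using that(1) by (simp add: ln_div)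
    then have "ln (M * q ^ l) \<le> ln \<epsilon>"
      using M q by (simp add: ln_mult ln_realpow)
    then show ?thesis
      using M q that(1) by simp
  qed
  show ?thesis
  proof (intro exI allI impI conjI)
    fix x x' t' al g k
    assume "algorithm_B S f A e fhat fstar x x' t' al g"
    then show "x' k \<in> Feas S A b"
      by (rule feasible_gap)
  next
    fix x x' t' al g and \<epsilon> :: real and l :: nat
    assume alg: "algorithm_B S f A e fhat fstar x x' t' al g"
      and l: "0 < \<epsilon> \<and> \<epsilon> < 1 \<and> real l \<ge> (1 / - ln q) * ln (1 / \<epsilon>) + ln M / - ln q"
    \<comment> \<open>The last iterate alone already meets the bound.\<close>
    have "(MIN k\<in>{..l}. (f (x' k) - ereal fstar) / ereal (fhat - fstar))
        \<le> (f (x' l) - ereal fstar) / ereal (fhat - fstar)"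
      by (intro Min_le) auto
    also have "\<dots> \<le> ereal (1 - al l)"
      by (rule feasible_gap(2)[OF alg])
    also have "\<dots> \<le> ereal \<epsilon>"
      using conv[OF alg, of l] rate[of \<epsilon> l] l by simp
    finally show "(MIN k\<in>{..l}. (f (x' k) - ereal fstar) / ereal (fhat - fstar)) \<le> ereal \<epsilon>" .
  qed
qed

end
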